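(* Let $G$ be a graph, let $k\geq\chi(G)$ be an integer, and let $S\subseteq V(G)$ be a subset of vertices that admits an equitable $k$-coloring. Then a $k$-coloring $\phi$ of $G$ is equitable over $S$ if and only if $\phi$ is a $k$-robust coloring of $(G,\overline{G}[S])$.
   Context: All graphs are finite, simple and unweighted. $\overline{G}$ is the complement of $G$, $\overline{G}[S]$ is the subgraph of $\overline{G}$ induced by $S$, and $\chi(G)$ is the chromatic number. A $k$-coloring of $G$ is a map $\phi:V(G)\to\{1,\dots,k\}$ with $\phi(u)\neq\phi(v)$ for every edge $uv$ of $G$. For a subgraph $H$ of $\overline{G}$, an edge $uv$ of $H$ is monochromatic under $\phi$ if $\phi(u)=\phi(v)$. A $k$-coloring is a $k$-robust coloring of $(G,H)$ if it minimizes, over all $k$-colorings of $G$, the number of monochromatic edges of $H$. A $k$-coloring $\phi$ of $G$ is equitable over $S$ if the numbers $n_i=|\phi^{-1}(i)\cap S|$, $1\le i\le k$, satisfy $|n_i-n_j|\leq 1$ for all $i,j$; $S$ admits an equitable $k$-coloring if some $k$-coloring of $G$ is equitable over $S$. *)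

theory Defs
  imports Main
begin

record 'a ugraph =
  verts :: "'a set"
  edges :: "'a set set"

definition simple_graph :: "'a ugraph \<Rightarrow> bool" where
  "simple_graph G \<longleftrightarrow> finite (verts G) \<and> (\<forall>e\<in>edges G. e \<subseteq> verts G \<and> card e = 2)"

definition complement :: "'a ugraph \<Rightarrow> 'a ugraph" where
  "complement G = \<lparr>verts = verts G, edges = {e. e \<subseteq> verts G \<and> card e = 2 \<and> e \<notin> edges G}\<rparr>"

definition induced :: "'a ugraph \<Rightarrow> 'a set \<Rightarrow> 'a ugraph" where
  "induced G S = \<lparr>verts = S, edges = {e \<in> edges G. e \<subseteq> S}\<rparr>"

text \<open>Colorings are total functions on the vertex type; values outside the vertex set are
  irrelevant to all notions below.\<close>

definition coloring :: "'a ugraph \<Rightarrow> nat \<Rightarrow> ('a \<Rightarrow> nat) \<Rightarrow> bool" where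
  "coloring G k \<phi> \<longleftrightarrow>
     \<phi> ` verts G \<subseteq> {1..k} \<and> (\<forall>u v. {u, v} \<in> edges G \<longrightarrow> \<phi> u \<noteq> \<phi> v)"

definition chromatic_number :: "'a ugraph \<Rightarrow> nat" where
  "chromatic_number G = (LEAST k. \<exists>\<phi>. coloring G k \<phi>)"

definition monochromatic_edges :: "'a ugraph \<Rightarrow> ('a \<Rightarrow> nat) \<Rightarrow> 'a set set" where
  "monochromatic_edges H \<phi> = {{u, v} | u v. {u, v} \<in> edges H \<and> \<phi> u = \<phi> v}"

definition robust_coloring :: "'a ugraph \<Rightarrow> 'a ugraph \<Rightarrow> nat \<Rightarrow> ('a \<Rightarrow> nat) \<Rightarrow> bool" where
  "robust_coloring G H k \<phi> \<longleftrightarrow>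
     is_arg_min (\<lambda>\<psi>. card (monochromatic_edges H \<psi>)) (coloring G k) \<phi>"

definition equitable_over :: "nat \<Rightarrow> 'a set \<Rightarrow> ('a \<Rightarrow> nat) \<Rightarrow> bool" where
  "equitable_over k S \<phi> \<longleftrightarrow>
     (\<forall>i\<in>{1..k}. \<forall>j\<in>{1..k}.
        \<bar>int (card (\<phi> -` {i} \<inter> S)) - int (card (\<phi> -` {j} \<inter> S))\<bar> \<le> 1)"

definition admits_equitable_coloring :: "'a ugraph \<Rightarrow> nat \<Rightarrow> 'a set \<Rightarrow> bool" where
  "admits_equitable_coloring G k S \<longleftrightarrow> (\<exists>\<phi>. coloring G k \<phi> \<and> equitable_over k S \<phi>)"

end

theory Submission
  imports Defs
begin

text \<open>If the colour classes of a colouring meet \<open>S\<close> in \<open>n\<^sub>1, \<dots>, n\<^sub>k\<close> vertices, then exactly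
  \<open>\<Sum>i. n\<^sub>i choose 2\<close> edges of the complement induced on \<open>S\<close> are monochromatic, because two
  vertices of the same colour are never adjacent in \<open>G\<close>. Among all \<open>n\<^sub>i\<close> with the fixed sum
  \<open>|S|\<close>, this sum is minimal exactly if the \<open>n\<^sub>i\<close> take only two consecutive values \<open>q\<close> and
  \<open>q + 1\<close>: up to terms depending only on \<open>|S|\<close>, \<open>k\<close> and \<open>q\<close>, twice the sum is
  \<open>\<Sum>i. (n\<^sub>i - q) (n\<^sub>i - q - 1)\<close>, whose summands are nonnegative and vanish only
  for \<open>n\<^sub>i \<in> {q, q + 1}\<close>.\<close>

text \<open>Equitability with the graph and the colouring stripped away, so that the extremal
  argument is one about class sizes alone.\<close>

definition balanced_on :: "'b set \<Rightarrow> ('b \<Rightarrow> nat) \<Rightarrow> bool" where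
  "balanced_on I n \<longleftrightarrow> (\<forall>i\<in>I. \<forall>j\<in>I. \<bar>int (n i) - int (n j)\<bar> \<le> 1)"

text \<open>Take \<open>q\<close> to be the minimum of \<open>n\<close> on \<open>I\<close>: every
  value is within 1 of the place where it is attained. For empty \<open>I\<close> any
  \<open>q\<close> will do.\<close>

lemma balanced_on_two_values:
  assumes "finite I" and "balanced_on I n"
  obtains q where "\<And>i. i \<in> I \<Longrightarrow> n i = q \<or> n i = Suc q"
proof (cases "I = {}")
  case True
  then show ?thesis using that by blast
next
  case False
  have "n i = Min (n ` I) \<or> n i = Suc (Min (n ` I))" if "i \<in> I" for i
  proof -
    have "Min (n ` I) \<in> n ` I" and "Min (n ` I) \<le> n i"
      using assms(1) False that by auto
    moreover from this(1) obtain j where "j \<in> I" "n j = Min (n ` I)" by auto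
    moreover from this(1) have "\<bar>int (n i) - int (n j)\<bar> \<le> 1"
      using assms(2) that by (auto simp: balanced_on_def)
    ultimately show ?thesis by linarith
  qed
  then show ?thesis using that by blast
qed

text \<open>No integer lies strictly between 0 and 1, so the two factors never have opposite
  signs.\<close>

lemma int_prod_consecutive_nonneg: "0 \<le> (x::int) * (x - 1)"
  by (cases "x \<le> 0") (auto simp: mult_nonpos_nonpos)

lemma double_choose_two_int: "2 * int (n choose 2) = int n * (int n - 1)"
proof -
  have "even (n * (n - 1))" by (cases n) auto
  then have "2 * (n choose 2) = n * (n - 1)" by (simp add: choose_two)
  then have "2 * int (n choose 2) = int (n * (n - 1))" by linarith
  \<comment> \<open>The case split deals with truncated subtraction: at \<open>n = 0\<close> the
    natural and the integer \<open>n - 1\<close> differ, but the factor \<open>n\<close> is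
    zero.\<close>
  then show ?thesis by (cases n) (auto simp: algebra_simps)
qed

text \<open>Termwise, x(x - 1) = (x - q)(x - q - 1) + 2qx - q(q + 1). The correction sees
  \<open>n\<close> only through its sum, hence cancels between families of equal total.\<close>

lemma sum_choose_two_shift:
  fixes n :: "'b \<Rightarrow> nat" and q :: int
  shows "2 * int (\<Sum>i\<in>I. n i choose 2) =
    (\<Sum>i\<in>I. (int (n i) - q) * (int (n i) - q - 1)) + 2 * q * int (sum n I) - int (card I) * (q * (q + 1))"
proof -
  have "2 * int (\<Sum>i\<in>I. n i choose 2) = (\<Sum>i\<in>I. int (n i) * (int (n i) - 1))"
    by (simp add: sum_distrib_left double_choose_two_int)
  also have "\<dots> = (\<Sum>i\<in>I. (int (n i) - q) * (int (n i) - q - 1) + 2 * q * int (n i) - q * (q + 1))"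
    by (rule sum.cong) (auto simp: algebra_simps)
  also have "\<dots> = (\<Sum>i\<in>I. (int (n i) - q) * (int (n i) - q - 1)) + 2 * q * int (sum n I) - int (card I) * (q * (q + 1))"
    by (simp add: sum_subtractf sum.distrib sum_distrib_left algebra_simps)
  finally show ?thesis .
qed

lemma balanced_on_minimizes_sum_choose_two:
  assumes "finite I" and "balanced_on I n" and "sum m I = sum n I"
  shows "(\<Sum>i\<in>I. n i choose 2) \<le> (\<Sum>i\<in>I. m i choose 2)"
    and "(\<Sum>i\<in>I. m i choose 2) = (\<Sum>i\<in>I. n i choose 2) \<Longrightarrow> balanced_on I m"
proof -
  obtain q where q: "\<And>i. i \<in> I \<Longrightarrow> n i = q \<or> n i = Suc q"
    using balanced_on_two_values[OF assms(1,2)] by blast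
  define d where "d f i = (int (f i) - int q) * (int (f i) - int q - 1)" for f :: "'a \<Rightarrow> nat" and i
  have d_nonneg: "0 \<le> d f i" for f i
    unfolding d_def by (rule int_prod_consecutive_nonneg)
  have "d n i = 0" if "i \<in> I" for i
    using q[OF that] by (auto simp: d_def)
  then have "sum (d n) I = 0" by simp
  then have excess: "2 * int (\<Sum>i\<in>I. m i choose 2) = 2 * int (\<Sum>i\<in>I. n i choose 2) + sum (d m) I"
    using sum_choose_two_shift[of m I "int q"] sum_choose_two_shift[of n I "int q"] 
    unfolding assms(3) d_def by linarith
  moreover have "0 \<le> sum (d m) I" by (simp add: sum_nonneg d_nonneg)
  ultimately show "(\<Sum>i\<in>I. n i choose 2) \<le> (\<Sum>i\<in>I. m i choose 2)" by linarith
  assume "(\<Sum>i\<in>I. m i choose 2) = (\<Sum>i\<in>I. n i choose 2)"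
  with excess have "sum (d m) I = 0" by simp
  then have "\<forall>i\<in>I. d m i = 0"
    using assms(1) d_nonneg by (simp add: sum_nonneg_eq_0_iff)
  \<comment> \<open>A vanishing product has a vanishing factor, so \<open>m\<close> takes its values
    in the same pair \<open>q\<close>, \<open>q + 1\<close> as \<open>n\<close>.\<close>
  then have "\<forall>i\<in>I. int (m i) = int q \<or> int (m i) = int q + 1"
    by (auto simp: d_def)
  then show "balanced_on I m"
    unfolding balanced_on_def by (smt (verit))
qed

lemma coloring_class_sizes_sum:
  assumes "finite S" and "\<phi> ` S \<subseteq> {1..k::nat}"
  shows "(\<Sum>i\<in>{1..k}. card (\<phi> -` {i} \<inter> S)) = card S"
proof -
  have "S = (\<Union>i\<in>{1..k}. \<phi> -` {i} \<inter> S)" using assms(2) by auto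
  then have "card S = card (\<Union>i\<in>{1..k}. \<phi> -` {i} \<inter> S)" by simp
  also have "\<dots> = (\<Sum>i\<in>{1..k}. card (\<phi> -` {i} \<inter> S))"
    using assms(1) by (intro card_UN_disjoint) auto
  finally show ?thesis by simp
qed

lemma monochromatic_edges_complement:
  assumes "S \<subseteq> verts G" and "coloring G k \<phi>"
  shows "monochromatic_edges (induced (complement G) S) \<phi> =
    (\<Union>i\<in>{1..k}. {e. e \<subseteq> \<phi> -` {i} \<inter> S \<and> card e = 2})" (is "?M = ?U")
proof
  show "?M \<subseteq> ?U"
  proof
    fix e assume "e \<in> ?M"
    then obtain u v where e: "e = {u, v}" "{u, v} \<subseteq> S" "card {u, v} = 2" "\<phi> u = \<phi> v"
      by (auto simp: monochromatic_edges_def induced_def complement_def)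
    moreover have "\<phi> u \<in> {1..k}"
      using assms e(2) unfolding coloring_def by blast
    ultimately show "e \<in> ?U" by auto
  qed
  show "?U \<subseteq> ?M"
  proof
    fix e assume "e \<in> ?U"
    then obtain i where e: "e \<subseteq> \<phi> -` {i} \<inter> S" "card e = 2" by auto
    from e(2) obtain u v where uv: "e = {u, v}" by (auto simp: card_2_iff)
    have "\<phi> u = \<phi> v" using e(1) uv by auto
    \<comment> \<open>Properness of the colouring is what places the pair in the complement.\<close>
    moreover from this have "{u, v} \<notin> edges G" using assms(2) by (auto simp: coloring_def)
    moreover have "{u, v} \<subseteq> S" "{u, v} \<subseteq> verts G" "card {u, v} = 2" using e uv assms(1) by auto
    ultimately show "e \<in> ?M"
      unfolding monochromatic_edges_def induced_def complement_def uv by auto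
  qed
qed

lemma card_monochromatic_edges_complement:
  assumes "finite S" and "S \<subseteq> verts G" and "coloring G k \<phi>"
  shows "card (monochromatic_edges (induced (complement G) S) \<phi>) =
    (\<Sum>i\<in>{1..k}. card (\<phi> -` {i} \<inter> S) choose 2)"
proof -
  let ?P = "\<lambda>i. {e. e \<subseteq> \<phi> -` {i} \<inter> S \<and> card e = 2}"
  \<comment> \<open>A set of size two is nonempty, so any of its elements determines the
    colour.\<close>
  have "?P i \<inter> ?P j = {}" if "i \<noteq> j" for i j
    using that by (auto simp: card_2_iff)
  moreover have "finite (?P i)" for i
    using assms(1) by (intro finite_subset[of "?P i" "Pow S"]) auto
  ultimately have "card (\<Union>i\<in>{1..k}. ?P i) = (\<Sum>i\<in>{1..k}. card (?P i))"
    by (intro card_UN_disjoint) auto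
  moreover have "card (?P i) = card (\<phi> -` {i} \<inter> S) choose 2" for i
    using assms(1) by (intro n_subsets) auto
  ultimately show ?thesis
    using monochromatic_edges_complement[OF assms(2,3)] by simp
qed

theorem theorem3:
  fixes G :: "'a ugraph" and k :: nat and S :: "'a set" and \<phi> :: "'a \<Rightarrow> nat"
  assumes "simple_graph G"
    and "k \<ge> chromatic_number G"
    and "S \<subseteq> verts G"
    and "admits_equitable_coloring G k S"
    and "coloring G k \<phi>"
  shows "equitable_over k S \<phi> \<longleftrightarrow> robust_coloring G (induced (complement G) S) k \<phi>"
proof -
  let ?n = "\<lambda>\<psi> i. card (\<psi> -` {i} \<inter> S)"
  let ?cost = "\<lambda>\<psi>. card (monochromatic_edges (induced (complement G) S) \<psi>)"
  have fin: "finite S"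
    using assms(1,3) finite_subset by (auto simp: simple_graph_def)
  have equitable: "equitable_over k S \<psi> \<longleftrightarrow> balanced_on {1..k} (?n \<psi>)" for \<psi>
    by (simp add: equitable_over_def balanced_on_def)
  have cost: "?cost \<psi> = (\<Sum>i\<in>{1..k}. ?n \<psi> i choose 2)" if "coloring G k \<psi>" for \<psi>
    using card_monochromatic_edges_complement[OF fin assms(3) that] .
  have total: "sum (?n \<psi>) {1..k} = card S" if "coloring G k \<psi>" for \<psi>
    using that assms(3) by (intro coloring_class_sizes_sum fin) (auto simp: coloring_def)
  have min: "?cost \<psi> \<le> ?cost \<psi>'" and eq: "?cost \<psi>' = ?cost \<psi> \<Longrightarrow> equitable_over k S \<psi>'"
    if "coloring G k \<psi>" "equitable_over k S \<psi>" "coloring G k \<psi>'" for \<psi> \<psi>'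
    using balanced_on_minimizes_sum_choose_two[of "{1..k}" "?n \<psi>" "?n \<psi>'"] that
      total[OF that(1)] total[OF that(3)]
    by (simp_all add: equitable cost)
  \<comment> \<open>By \<open>min\<close>, this witness attains the least cost. A robust
    \<open>\<phi>\<close> must therefore match it, and \<open>eq\<close> makes \<open>\<phi>\<close>
    equitable.\<close>
  obtain \<psi> where \<psi>: "coloring G k \<psi>" "equitable_over k S \<psi>"
    using assms(4) by (auto simp: admits_equitable_coloring_def)
  show ?thesis
  proof
    assume "equitable_over k S \<phi>"
    then show "robust_coloring G (induced (complement G) S) k \<phi>"
      using min assms(5) by (auto simp: robust_coloring_def is_arg_min_def not_less)
  next
    assume "robust_coloring G (induced (complement G) S) k \<phi>"
    then have "?cost \<phi> \<le> ?cost \<psi>"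
      using \<psi>(1) by (auto simp: robust_coloring_def is_arg_min_def not_less)
    then show "equitable_over k S \<phi>"
      using min[OF \<psi> assms(5)] eq[OF \<psi> assms(5)] by simp
  qed
qed

end
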